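(* For all integers $i,j\geq 3$ with $i\neq j$ and $i\neq j+1$, the graph polynomials $\mathbf{P}^{ind}_{\mathcal{C}_i}$ and $\mathbf{P}^{ind}_{\mathcal{C}_j}$ are d.p.-incomparable, i.e., neither $\mathbf{P}^{ind}_{\mathcal{C}_i}\leq_{d.p.}\mathbf{P}^{ind}_{\mathcal{C}_j}$ nor $\mathbf{P}^{ind}_{\mathcal{C}_j}\leq_{d.p.}\mathbf{P}^{ind}_{\mathcal{C}_i}$. Hence there are infinitely many d.p.-inequivalent graph polynomials of the form $\mathbf{P}^{ind}_{\mathcal{C}}(G;X)$ with $\mathcal{C}$ a graph property.
   Context: All graphs are finite without multiple edges. $C_i$ is the cycle on $i$ vertices and $\mathcal{C}_i$ is the graph property consisting of all graphs isomorphic to $C_i$. For a graph property $\mathcal{C}$, $\mathbf{P}^{ind}_{\mathcal{C}}(G;X)=\sum_{A\subseteq V(G):G[A]\in\mathcal{C}}X^{|A|}$ with $G[A]$ the induced subgraph on $A$. $\mathbf{P}\leq_{d.p.}\mathbf{Q}$ means: for all graphs $G_1,G_2$, $\mathbf{Q}(G_1)=\mathbf{Q}(G_2)$ implies $\mathbf{P}(G_1)=\mathbf{P}(G_2)$. *)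

theory Defs
  imports "Graph_Theory.Graph_Theory" "HOL-Computational_Algebra.Polynomial"
begin

text \<open>
  An undirected graph without multiple edges is a symmetric relation on its vertex set. Loops are
  permitted: only multiple edges are excluded. Vertices are natural numbers, which represents every
  finite graph up to isomorphism; the graph without vertices is included.
\<close>

type_synonym ngraph = "nat pair_pre_digraph"

abbreviation is_graph :: "ngraph \<Rightarrow> bool" where
  "is_graph \<equiv> pair_pseudo_graph"

definition graph_iso :: "ngraph \<Rightarrow> ngraph \<Rightarrow> bool" where
  "graph_iso G H \<longleftrightarrow> digraph_iso (with_proj G) (with_proj H)"

definition induced :: "ngraph \<Rightarrow> nat set \<Rightarrow> ngraph" where
  "induced G A = \<lparr> pverts = A, parcs = {e \<in> parcs G. fst e \<in> A \<and> snd e \<in> A} \<rparr>"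

lemma with_proj_induced: "with_proj (induced G A) = induce_subgraph (with_proj G) A"
  by (simp add: induced_def induce_subgraph_def with_proj_def)

definition graph_property :: "ngraph set \<Rightarrow> bool" where
  "graph_property C \<longleftrightarrow>
     (\<forall>G \<in> C. is_graph G) \<and>
     (\<forall>G H. G \<in> C \<longrightarrow> is_graph H \<longrightarrow> graph_iso G H \<longrightarrow> H \<in> C)"

definition cycle_graph :: "nat \<Rightarrow> ngraph" where
  "cycle_graph n =
     \<lparr> pverts = {..<n},
       parcs = {(u, v). u < n \<and> v < n \<and> (v = Suc u mod n \<or> u = Suc v mod n)} \<rparr>"

definition cycle_property :: "nat \<Rightarrow> ngraph set" where
  "cycle_property n = {G. is_graph G \<and> graph_iso G (cycle_graph n)}"

definition P_ind :: "ngraph set \<Rightarrow> ngraph \<Rightarrow> int poly" where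
  "P_ind C G = (\<Sum>A | A \<subseteq> pverts G \<and> induced G A \<in> C. monom 1 (card A))"

definition dp_le :: "(ngraph \<Rightarrow> int poly) \<Rightarrow> (ngraph \<Rightarrow> int poly) \<Rightarrow> bool" where
  "dp_le P Q \<longleftrightarrow>
     (\<forall>G1 G2. is_graph G1 \<longrightarrow> is_graph G2 \<longrightarrow> Q G1 = Q G2 \<longrightarrow> P G1 = P G2)"

definition dp_incomparable :: "(ngraph \<Rightarrow> int poly) \<Rightarrow> (ngraph \<Rightarrow> int poly) \<Rightarrow> bool" where
  "dp_incomparable P Q \<longleftrightarrow> \<not> dp_le P Q \<and> \<not> dp_le Q P"

definition dp_equivalent :: "(ngraph \<Rightarrow> int poly) \<Rightarrow> (ngraph \<Rightarrow> int poly) \<Rightarrow> bool" where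
  "dp_equivalent P Q \<longleftrightarrow> dp_le P Q \<and> dp_le Q P"

lemma is_graph_cycle_graph: "is_graph (cycle_graph n)"
proof -
  have "finite (parcs (cycle_graph n))"
    by (rule finite_subset[of _ "{..<n} \<times> {..<n}"]) (auto simp: cycle_graph_def)
  then show ?thesis
    by unfold_locales (auto simp: symmetric_def cycle_graph_def sym_def)
qed

lemma graph_property_cycle_property: "graph_property (cycle_property n)"
  unfolding graph_property_def
proof (intro conjI allI impI ballI)
  fix G assume "G \<in> cycle_property n"
  then show "is_graph G" by (simp add: cycle_property_def)
next
  fix G H
  assume G: "G \<in> cycle_property n" and H: "is_graph H" and iso: "graph_iso G H"
  from G have gG: "is_graph G" and c: "digraph_iso G (cycle_graph n)"
    by (auto simp: cycle_property_def graph_iso_def)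
  interpret G: pair_pseudo_graph G by (fact gG)
  from iso have "digraph_iso H G"
    using G.wf_digraph_axioms digraph_iso_swap unfolding graph_iso_def by blast
  with c have "digraph_iso H (cycle_graph n)"
    using digraph_iso_trans by blast
  with H show "H \<in> cycle_property n"
    by (simp add: cycle_property_def graph_iso_def)
qed

lemma equiv_dp_equivalent: "equiv UNIV {(P, Q). dp_equivalent P Q}"
proof (rule equivI)
  show "refl {(P, Q). dp_equivalent P Q}"
    by (simp add: refl_on_def dp_equivalent_def dp_le_def)
  show "sym {(P, Q). dp_equivalent P Q}"
    by (simp add: sym_def dp_equivalent_def)
  show "trans {(P, Q). dp_equivalent P Q}"
    unfolding trans_def dp_equivalent_def dp_le_def mem_Collect_eq prod.case by meson
qed simp

end

theory Submission
  imports Defs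
begin

text \<open>
  The polynomial of \<open>C\<^sub>i\<close> separates the cycle on \<open>i\<close> vertices from the graph without vertices, while
  the polynomial of \<open>C\<^sub>j\<close> with \<open>j \<noteq> i\<close> vanishes on both: a proper nonempty vertex subset of a cycle
  contains a vertex whose successor is missing, so it induces a subgraph with a vertex of degree
  at most 1, which is not a cycle.
\<close>

text \<open>The successor map modulo \<open>n\<close> is a bijection on \<open>{..<n}\<close>, so
  \<open>u\<close> has one successor and one predecessor. The case split writes the predecessor
  without truncated subtraction at 0.\<close>

lemma out_arcs_cycle_graph:
  assumes "u < n"
  shows "out_arcs (cycle_graph n) u
    = {(u, Suc u mod n), (u, if u = 0 then n - 1 else u - 1)}"
proof -
  let ?p = "if u = 0 then n - 1 else u - 1"
  have "u = Suc v mod n \<longleftrightarrow> v = ?p" if "v < n" for v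
    using assms that by (auto simp: mod_Suc)
  moreover have "out_arcs (cycle_graph n) u
      = Pair u ` {v. v < n \<and> (v = Suc u mod n \<or> u = Suc v mod n)}"
    using assms by (auto simp: cycle_graph_def)
  ultimately have "out_arcs (cycle_graph n) u = Pair u ` {v. v < n \<and> (v = Suc u mod n \<or> v = ?p)}"
    by (simp cong: conj_cong)
  also have "{v. v < n \<and> (v = Suc u mod n \<or> v = ?p)} = {Suc u mod n, ?p}"
    using assms by auto
  finally show ?thesis by simp
qed

text \<open>For \<open>n \<ge> 3\<close> the successor and the predecessor differ; for
  \<open>n = 1\<close> and \<open>n = 2\<close> they coincide.\<close>

lemma out_degree_cycle_graph:
  assumes "n \<ge> 3" and "u < n"
  shows "out_degree (cycle_graph n) u = 2"
proof -
  have "Suc u mod n \<noteq> (if u = 0 then n - 1 else u - 1)"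
    using assms by (auto simp: mod_Suc)
  then show ?thesis
    using assms by (simp add: out_degree_def out_arcs_cycle_graph)
qed

lemma cycle_property_card:
  assumes "G \<in> cycle_property n"
  shows "card (pverts G) = n"
proof -
  obtain f where f: "pre_digraph.digraph_isomorphism (with_proj G) f"
    and eq: "with_proj (cycle_graph n) = app_iso f (with_proj G)"
    using assms by (auto simp: cycle_property_def graph_iso_def digraph_iso_def)
  have "{..<n} = iso_verts f ` pverts G"
    using arg_cong[OF eq, of verts] by (simp add: cycle_graph_def)
  moreover have "inj_on (iso_verts f) (pverts G)"
    using pre_digraph.digraph_isomorphism_inj_on_verts[OF f] by simp
  ultimately show ?thesis
    by (metis card_image card_lessThan)
qed

text \<open>Out-degree is invariant under isomorphism, so the value 2 carries over from
  \<open>cycle_graph n\<close>.\<close>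

lemma cycle_property_out_degree:
  assumes "G \<in> cycle_property n" and "n \<ge> 3" and "u \<in> pverts G"
  shows "out_degree G u = 2"
proof -
  obtain f where f: "pre_digraph.digraph_isomorphism (with_proj G) f"
    and eq: "with_proj (cycle_graph n) = app_iso f (with_proj G)"
    using assms by (auto simp: cycle_property_def graph_iso_def digraph_iso_def)
  have "{..<n} = iso_verts f ` pverts G"
    using arg_cong[OF eq, of verts] by (simp add: cycle_graph_def)
  then have "iso_verts f u < n"
    using assms(3) by blast
  moreover have "wf_digraph (with_proj G)"
    using f by (simp add: pre_digraph.digraph_isomorphism_def)
  ultimately show ?thesis
    using wf_digraph.out_degree_app_iso_eq[OF _ f, of u] out_degree_cycle_graph[of n] assms
    by (simp flip: eq)
qed

lemma cycle_graph_in_cycle_property: "cycle_graph n \<in> cycle_property n"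
proof -
  interpret pair_pseudo_graph "cycle_graph n" by (rule is_graph_cycle_graph)
  have "digraph_iso (cycle_graph n) (cycle_graph n)"
    unfolding digraph_iso_def
    \<comment> \<open>The identity map; \<open>snd\<close> and \<open>fst\<close> are the head and
      tail functions that \<open>with_proj\<close> supplies.\<close>
    by (rule exI[of _ "\<lparr>iso_verts = id, iso_arcs = id, iso_head = snd, iso_tail = fst\<rparr>"])
      (simp add: digraph_isomorphism_def app_iso_def wf_digraph_axioms flip: with_proj_def)
  then show ?thesis
    by (simp add: cycle_property_def graph_iso_def is_graph_cycle_graph)
qed

text \<open>Repeated steps to the successor from any one element run through all residues modulo
  \<open>n\<close>.\<close>

lemma Suc_mod_closed_eq_lessThan:
  fixes A :: "nat set"
  assumes "A \<subseteq> {..<n}" and "A \<noteq> {}" and closed: "\<And>a. a \<in> A \<Longrightarrow> Suc a mod n \<in> A"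
  shows "A = {..<n}"
proof -
  obtain a where a: "a \<in> A" "a < n"
    using assms by auto
  have iter: "(a + k) mod n \<in> A" for k
  proof (induction k)
    case 0
    then show ?case using a by simp
  next
    case (Suc k)
    then show ?case using closed[OF Suc] by (simp add: mod_Suc_eq)
  qed
  have "v \<in> A" if "v < n" for v
    \<comment> \<open>From \<open>a\<close>, this many steps lead to \<open>n + v\<close>, which is
      \<open>v\<close> modulo \<open>n\<close>; the extra \<open>n\<close> covers the case
      \<open>v < a\<close>.\<close>
    using iter[of "n - a + v"] a that by simp
  then show ?thesis
    using assms(1) by auto
qed

lemma induced_cycle_graph_in_cycle_property_iff:
  assumes "j \<ge> 3" and sub: "A \<subseteq> {..<i}"
  shows "induced (cycle_graph i) A \<in> cycle_property j \<longleftrightarrow> i = j \<and> A = {..<i}"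
proof
  assume cyc: "induced (cycle_graph i) A \<in> cycle_property j"
  have card: "card A = j"
    using cycle_property_card[OF cyc] by (simp add: induced_def)
  have "Suc a mod i \<in> A" if a: "a \<in> A" for a
  proof (rule ccontr)
    assume "Suc a mod i \<notin> A"
    \<comment> \<open>With the successor of \<open>a\<close> missing, only the arc to the
      predecessor can remain, against out-degree 2 in a cycle.\<close>
    then have "out_arcs (induced (cycle_graph i) A) a
        \<subseteq> out_arcs (cycle_graph i) a - {(a, Suc a mod i)}"
      by (auto simp: induced_def)
    also have "\<dots> \<subseteq> {(a, if a = 0 then i - 1 else a - 1)}"
      using a sub by (subst out_arcs_cycle_graph) auto
    finally have "out_degree (induced (cycle_graph i) A) a \<le> 1"
      unfolding out_degree_def by (auto dest: card_mono[rotated])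
    moreover have "out_degree (induced (cycle_graph i) A) a = 2"
      using cycle_property_out_degree[OF cyc assms(1)] a by (simp add: induced_def)
    ultimately show False by simp
  qed
  then have "A = {..<i}"
    \<comment> \<open>\<open>A\<close> is nonempty because it has \<open>j \<ge> 3\<close>
      elements.\<close>
    using sub card assms(1) by (intro Suc_mod_closed_eq_lessThan) auto
  with card show "i = j \<and> A = {..<i}" by simp
next
  have "induced (cycle_graph i) {..<i} = cycle_graph i"
    by (auto simp: induced_def cycle_graph_def)
  then show "i = j \<and> A = {..<i} \<Longrightarrow> induced (cycle_graph i) A \<in> cycle_property j"
    by (auto intro: cycle_graph_in_cycle_property)
qed

text \<open>The index \<open>i\<close> is arbitrary, so that \<open>i = 0\<close> covers the graph
  without vertices.\<close>

lemma P_ind_cycle_property_cycle_graph: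
  assumes "j \<ge> 3"
  shows "P_ind (cycle_property j) (cycle_graph i) = (if i = j then monom 1 i else 0)"
proof -
  have "{A. A \<subseteq> pverts (cycle_graph i) \<and> induced (cycle_graph i) A \<in> cycle_property j}
      = (if i = j then {{..<i}} else {})"
    using induced_cycle_graph_in_cycle_property_iff[OF assms] by (auto simp: cycle_graph_def)
  then show ?thesis
    by (simp add: P_ind_def)
qed

lemma not_dp_le_cycle_property:
  assumes "i \<ge> 3" and "j \<ge> 3" and "i \<noteq> j"
  shows "\<not> dp_le (P_ind (cycle_property i)) (P_ind (cycle_property j))"
proof
  assume "dp_le (P_ind (cycle_property i)) (P_ind (cycle_property j))"
  \<comment> \<open>Both sides are 0, since \<open>j\<close> is neither \<open>i\<close> nor
    0.\<close>
  moreover have "P_ind (cycle_property j) (cycle_graph i) = P_ind (cycle_property j) (cycle_graph 0)"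
    using assms by (simp add: P_ind_cycle_property_cycle_graph)
  ultimately have "P_ind (cycle_property i) (cycle_graph i) = P_ind (cycle_property i) (cycle_graph 0)"
    using is_graph_cycle_graph unfolding dp_le_def by blast
  \<comment> \<open>The left side is the nonzero \<open>monom 1 i\<close>, the right side is
    0.\<close>
  then show False
    using assms by (simp add: P_ind_cycle_property_cycle_graph)
qed

theorem theorem12:
  shows "(\<forall>i j :: nat. i \<ge> 3 \<longrightarrow> j \<ge> 3 \<longrightarrow> i \<noteq> j \<longrightarrow> i \<noteq> j + 1 \<longrightarrow>
            dp_incomparable (P_ind (cycle_property i)) (P_ind (cycle_property j)))
       \<and> infinite ({P_ind C | C. graph_property C} // {(P, Q). dp_equivalent P Q})"
proof (intro conjI allI impI)
  fix i j :: nat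
  assume "i \<ge> 3" "j \<ge> 3" "i \<noteq> j" "i \<noteq> j + 1"
  then show "dp_incomparable (P_ind (cycle_property i)) (P_ind (cycle_property j))"
    by (simp add: dp_incomparable_def not_dp_le_cycle_property)
next
  let ?R = "{(P, Q). dp_equivalent P Q}"
  let ?cls = "\<lambda>n. ?R `` {P_ind (cycle_property n)}"
  \<comment> \<open>Equal classes would make the two polynomials equivalent, which is excluded for
    distinct cycle lengths; so the classes of the cycle properties alone are infinitely
    many.\<close>
  have "inj_on ?cls {3..}"
  proof (rule inj_onI)
    fix i j :: nat
    assume "i \<in> {3..}" "j \<in> {3..}" and eq: "?cls i = ?cls j"
    moreover have "dp_equivalent (P_ind (cycle_property i)) (P_ind (cycle_property j))"
      using eq_equiv_class[OF eq equiv_dp_equivalent] by simp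
    ultimately show "i = j"
      using not_dp_le_cycle_property[of i j] by (auto simp: dp_equivalent_def)
  qed
  then have "infinite (?cls ` {3..})"
    by (simp add: finite_image_iff infinite_Ici)
  moreover have "?cls ` {3..} \<subseteq> {P_ind C | C. graph_property C} // ?R"
    using graph_property_cycle_property by (blast intro: quotientI)
  ultimately show "infinite ({P_ind C | C. graph_property C} // ?R)"
    using finite_subset by blast
qed

end
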